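(* Let $\theta$ be a primitive substitution on $\{0,1\}^*$ of Salem type such that $\theta(0)$ begins with the letter $0$ and $\theta(1)$ begins with the letter $1$. Let $w$ be a Perron-Frobenius right eigenvector of $M_\theta$. Suppose that the set of irreducible $w$-balanced blocks (with their shapes) occurring in the decomposition of the double sequence $\binom{u^*}{v^*}$ is finite, and contains both $\hat{0}$ and $\hat{0}_\natural$. Then the coincidence density of $\theta$ does not exist, i.e. the limit $$\lim_{n\to\infty}\frac1n\,\mathrm{Card}\{1\le k\le n:\ u^*_k=v^*_k\}$$ does not exist.
   Context: A substitution $\theta$ on $\{0,1\}$ is a monoid morphism of $\{0,1\}^*$ sending each letter to a nonempty word. Its matrix $M_\theta$ is the $2\times2$ matrix whose entry $M_\theta(i,j)$ is the number of occurrences of the letter $j$ in $\theta(i)$, for $i,j\in\{0,1\}$; $\theta$ is primitive if some power of $M_\theta$ has all entries positive. The eigenvalues of $M_\theta$ are denoted $\lambda$ (the Perron-Frobenius eigenvalue, of largest modulus) and $\lambda^o$. $\theta$ is of Salem type if the second eigenvalue lies on the unit circle: $|\lambda^o|=1$. A Perron-Frobenius right eigenvector $w=(w_0,w_1)^T$ has positive entries and satisfies $M_\theta w=\lambda w$. $u^*=\theta^\infty(0)=u^*_1u^*_2\dots$ and $v^*=\theta^\infty(1)=v^*_1v^*_2\dots$ are the fixed points of $\theta$ beginning with $0$ and $1$ respectively. The coincidence density of $\theta$ is $\delta_c=\lim_{n\to\infty}\frac1n\mathrm{Card}\{1\le k\le n: u^*_k=v^*_k\}$, when this limit exists. For a word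 $A$ let $N(A)=(N_0(A),N_1(A))^T$, where $N_i(A)$ is the number of occurrences of $i$ in $A$. A pair of nonempty words $\binom{A}{B}$ is a $w$-balanced block if $N(A)^Tw=N(B)^Tw$; the words need not have equal length. A $w$-balanced block is irreducible if it is not the concatenation of two (nonempty) $w$-balanced blocks. The decomposition of the double sequence $\binom{u^*}{v^*}$ (with $u^*$ written above $v^*$) into irreducible $w$-balanced blocks is as follows. Call $(p,q)$, with integers $p,q\ge0$, a cut if $N(u^*_1\dots u^*_p)^Tw=N(v^*_1\dots v^*_q)^Tw$. For consecutive cuts $(p,q)$, $(p',q')$ (ordered by increasing $p$) the corresponding irreducible block is $\binom{A}{B}$ with $A=u^*_{p+1}\dots u^*_{p'}$ and $B=v^*_{q+1}\dots v^*_{q'}$. Blocks carry a shape: the left slope of this block is $s=p-q$ (the upper word starts $s$ columns to the right of the lower word), and its right slope is $|A|-|B|+s=p'-q'$, where $|\cdot|$ denotes word length. Two blocks are the same if they have the same words $A,B$ and the same left slope. $\hat{0}$ denotes the block $\binom{0}{0}$ with left slope $0$ (and right slope $0$). $\hat{0}_\natural$ denotes the skewed block $\binom{0}{0}$ with left slope $1$ (and right slope $1$): its upper letter $0$ is positioned one column to the right of its lower letter $0$. *)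

theory Defs
  imports "Jordan_Normal_Form.Spectral_Radius"
begin

text \<open>Words over \<open>{0,1}\<close> are lists of naturals. A substitution is given by the images of the
  letters, so only the values \<open>\<theta> 0\<close> and \<open>\<theta> 1\<close> matter.\<close>

definition substitution :: "(nat \<Rightarrow> nat list) \<Rightarrow> bool" where
  "substitution \<theta> \<longleftrightarrow> (\<forall>i\<in>{0,1}. \<theta> i \<noteq> [] \<and> set (\<theta> i) \<subseteq> {0,1})"

definition subst_word :: "(nat \<Rightarrow> nat list) \<Rightarrow> nat list \<Rightarrow> nat list" where
  "subst_word \<theta> x = concat (map \<theta> x)"

definition subst_mat :: "(nat \<Rightarrow> nat list) \<Rightarrow> nat mat" where
  "subst_mat \<theta> = mat 2 2 (\<lambda>(i, j). count_list (\<theta> i) j)"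

definition primitive_subst :: "(nat \<Rightarrow> nat list) \<Rightarrow> bool" where
  "primitive_subst \<theta> \<longleftrightarrow> (\<exists>n. \<forall>i<2. \<forall>j<2. 0 < (subst_mat \<theta> ^\<^sub>m n) $$ (i, j))"

abbreviation subst_cmat :: "(nat \<Rightarrow> nat list) \<Rightarrow> complex mat" where
  "subst_cmat \<theta> \<equiv> map_mat of_nat (subst_mat \<theta>)"

definition pf_eigenvalue :: "(nat \<Rightarrow> nat list) \<Rightarrow> real" where
  "pf_eigenvalue \<theta> = spectral_radius (subst_cmat \<theta>)"

definition salem_type :: "(nat \<Rightarrow> nat list) \<Rightarrow> bool" where
  "salem_type \<theta> \<longleftrightarrow>
     (\<exists>\<mu>. spectrum (subst_cmat \<theta>) = {of_real (pf_eigenvalue \<theta>), \<mu>} \<and> cmod \<mu> = 1)"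

definition pf_right_eigenvector :: "(nat \<Rightarrow> nat list) \<Rightarrow> real vec \<Rightarrow> bool" where
  "pf_right_eigenvector \<theta> w \<longleftrightarrow>
     eigenvector (map_mat of_nat (subst_mat \<theta>)) w (pf_eigenvalue \<theta>) \<and> 0 < w $ 0 \<and> 0 < w $ 1"

text \<open>\<open>\<theta>\<^sup>\<infinity>(a)\<close> is the letterwise limit of the words \<open>\<theta>\<^sup>n(a)\<close>, meaningful when these words are
  prefixes of one another with unbounded lengths. Positions are counted from \<open>0\<close>, so
  \<open>subst_limit \<theta> a k\<close> is the letter in position \<open>k + 1\<close> of the infinite word when positions are
  counted from \<open>1\<close>.\<close>

definition subst_limit :: "(nat \<Rightarrow> nat list) \<Rightarrow> nat \<Rightarrow> nat \<Rightarrow> nat" where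
  "subst_limit \<theta> a k =
     (THE c. \<forall>\<^sub>F n in sequentially.
        k < length ((subst_word \<theta> ^^ n) [a]) \<and> (subst_word \<theta> ^^ n) [a] ! k = c)"

definition letter_counts :: "nat list \<Rightarrow> real vec" where
  "letter_counts x = vec 2 (\<lambda>i. of_nat (count_list x i))"

definition balanced_block :: "real vec \<Rightarrow> nat list \<Rightarrow> nat list \<Rightarrow> bool" where
  "balanced_block w A B \<longleftrightarrow>
     A \<noteq> [] \<and> B \<noteq> [] \<and> letter_counts A \<bullet> w = letter_counts B \<bullet> w"

definition irreducible_block :: "real vec \<Rightarrow> nat list \<Rightarrow> nat list \<Rightarrow> bool" where
  "irreducible_block w A B \<longleftrightarrow> balanced_block w A B \<and>
     \<not> (\<exists>A1 A2 B1 B2. A = A1 @ A2 \<and> B = B1 @ B2 \<and>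
          balanced_block w A1 B1 \<and> balanced_block w A2 B2)"

definition is_cut :: "real vec \<Rightarrow> (nat \<Rightarrow> nat) \<Rightarrow> (nat \<Rightarrow> nat) \<Rightarrow> nat \<Rightarrow> nat \<Rightarrow> bool" where
  "is_cut w u v p q \<longleftrightarrow>
     letter_counts (map u [0..<p]) \<bullet> w = letter_counts (map v [0..<q]) \<bullet> w"

definition consecutive_cuts ::
    "real vec \<Rightarrow> (nat \<Rightarrow> nat) \<Rightarrow> (nat \<Rightarrow> nat) \<Rightarrow> nat \<Rightarrow> nat \<Rightarrow> nat \<Rightarrow> nat \<Rightarrow> bool" where
  "consecutive_cuts w u v p q p' q' \<longleftrightarrow>
     is_cut w u v p q \<and> is_cut w u v p' q' \<and> p < p' \<and>
     \<not> (\<exists>r s. p < r \<and> r < p' \<and> is_cut w u v r s)"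

text \<open>A block is a triple \<open>(A, B, s)\<close> of its upper word, its lower word and its left slope; its right
  slope \<open>|A| - |B| + s\<close> is determined by these data.\<close>

type_synonym block = "nat list \<times> nat list \<times> int"

definition decomposition_blocks ::
    "real vec \<Rightarrow> (nat \<Rightarrow> nat) \<Rightarrow> (nat \<Rightarrow> nat) \<Rightarrow> block set" where
  "decomposition_blocks w u v =
     {(map u [p..<p'], map v [q..<q'], int p - int q) | p q p' q'. consecutive_cuts w u v p q p' q'}"

definition zero_hat :: block where
  "zero_hat = ([0], [0], 0)"

definition zero_hat_skewed :: block where
  "zero_hat_skewed = ([0], [0], 1)"

text \<open>The blocks cut out by consecutive cuts are indeed irreducible balanced blocks.\<close>

lemma letter_counts_scalar:
  assumes "w \<in> carrier_vec 2"
  shows "letter_counts x \<bullet> w = real (count_list x 0) * w $ 0 + real (count_list x 1) * w $ 1"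
proof -
  have "{0..<2::nat} = {0, 1}" by auto
  then show ?thesis using assms by (auto simp: letter_counts_def scalar_prod_def)
qed

lemma letter_counts_append:
  assumes "w \<in> carrier_vec 2"
  shows "letter_counts (x @ y) \<bullet> w = letter_counts x \<bullet> w + letter_counts y \<bullet> w"
  by (simp add: letter_counts_scalar[OF assms] algebra_simps)

lemma letter_counts_pos:
  assumes "w \<in> carrier_vec 2" "0 < w $ 0" "0 < w $ 1" "x \<noteq> []" "set x \<subseteq> {0,1}"
  shows "0 < letter_counts x \<bullet> w"
proof -
  have "\<exists>c\<in>{0,1}. c \<in> set x" using assms(4,5) by (cases x) auto
  then have "0 < count_list x 0 \<or> 0 < count_list x 1"
    by (metis count_list_0_iff gr0I insertE singletonD)
  then show ?thesis
    using assms(2,3) unfolding letter_counts_scalar[OF assms(1)]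
    by (metis add_nonneg_pos add_pos_nonneg less_imp_le mult_nonneg_nonneg mult_pos_pos
        of_nat_0_le_iff of_nat_0_less_iff)
qed

lemma map_upt_append:
  assumes "i \<le> j" "j \<le> k"
  shows "map f [i..<k] = map f [i..<j] @ map f [j..<k]"
  using assms by (metis le_add_diff_inverse map_append upt_add_eq_append)

lemma decomposition_blocks_irreducible:
  assumes w: "w \<in> carrier_vec 2" "0 < w $ 0" "0 < w $ 1"
    and u: "range u \<subseteq> {0,1}" and v: "range v \<subseteq> {0,1}"
    and AB: "(A, B, s) \<in> decomposition_blocks w u v"
  shows "irreducible_block w A B"
proof -
  obtain p q p' q' where A: "A = map u [p..<p']" and B: "B = map v [q..<q']"
    and cc: "consecutive_cuts w u v p q p' q'"
    using AB unfolding decomposition_blocks_def by auto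
  let ?W = "\<lambda>x. letter_counts x \<bullet> w"
  have pos: "0 < ?W x" if "x \<noteq> []" "set x \<subseteq> {0,1}" for x
    using letter_counts_pos[OF w that] .
  have pp: "p < p'" and c: "?W (map u [0..<p]) = ?W (map v [0..<q])"
    and c': "?W (map u [0..<p']) = ?W (map v [0..<q'])"
    and no: "\<And>r s. p < r \<Longrightarrow> r < p' \<Longrightarrow> ?W (map u [0..<r]) \<noteq> ?W (map v [0..<s])"
    using cc unfolding consecutive_cuts_def is_cut_def by auto
  have add: "?W (map f [0..<k]) = ?W (map f [0..<j]) + ?W (map f [j..<k])" if "j \<le> k" for f j k
    using map_upt_append[of 0 j k f] that letter_counts_append[OF w(1)] by simp
  have Wu: "?W (map u [0..<p']) = ?W (map u [0..<p]) + ?W A"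
    unfolding A using add pp by simp
  have Apos: "0 < ?W A"
  proof (rule pos)
    show "A \<noteq> []" using pp A by simp
    show "set A \<subseteq> {0,1}" unfolding A set_map by (rule order_trans[OF image_mono[OF subset_UNIV] u])
  qed
  have qq: "q < q'"
  proof (rule ccontr)
    assume "\<not> q < q'"
    then have "?W (map v [0..<q]) = ?W (map v [0..<q']) + ?W (map v [q'..<q])"
      using add by simp
    moreover have "0 \<le> ?W (map v [q'..<q])"
      using letter_counts_scalar[OF w(1)] w(2,3) by simp
    ultimately show False using c c' Wu Apos by linarith
  qed
  have Wv: "?W (map v [0..<q']) = ?W (map v [0..<q]) + ?W B"
    unfolding B using add qq by simp
  have bal: "balanced_block w A B"
    unfolding balanced_block_def using c c' Wu Wv pp qq A B by simp
  have False if h: "A = A1 @ A2" "B = B1 @ B2" "balanced_block w A1 B1" "balanced_block w A2 B2"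
    for A1 A2 B1 B2
  proof -
    let ?r = "p + length A1" and ?s = "q + length B1"
    have ne: "A1 \<noteq> []" "A2 \<noteq> []" and eq: "?W A1 = ?W B1"
      using h(3,4) unfolding balanced_block_def by auto
    have lA: "length A1 + length A2 = p' - p" and lB: "length B1 + length B2 = q' - q"
      using arg_cong[OF h(1), of length] arg_cong[OF h(2), of length] A B by auto
    have r: "p < ?r" "?r < p'" and s: "q \<le> ?s" "?s \<le> q'"
      using ne[folded length_greater_0_conv] lA lB pp qq by linarith+
    have "map u [p..<?r] @ map u [?r..<p'] = A1 @ A2"
      using map_upt_append[of p ?r p' u] r h(1) A by simp
    then have A1: "map u [p..<?r] = A1" by (metis append_eq_append_conv diff_add_inverse length_map length_upt)
    have "map v [q..<?s] @ map v [?s..<q'] = B1 @ B2"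
      using map_upt_append[of q ?s q' v] s h(2) B by simp
    then have B1: "map v [q..<?s] = B1" by (metis append_eq_append_conv diff_add_inverse length_map length_upt)
    have "?W (map u [0..<?r]) = ?W (map v [0..<?s])"
      using add[of p ?r u] add[of q ?s v] unfolding A1 B1 eq c by simp
    then show False using no r by blast
  qed
  then show ?thesis using bal unfolding irreducible_block_def by blast
qed

end

theory Submission
  imports Defs "HOL-Library.Sublist"
begin

text \<open>
  The difference of the letter counts of two words of equal \<open>w\<close>-weight is a left eigenvector of
  \<open>M\<^sub>\<theta>\<close> for the second eigenvalue, which is \<open>\<plusminus>1\<close> because it is real and of modulus one.
  Hence \<open>\<theta>\<^sup>2\<close> preserves slopes. Applying even powers of \<open>\<theta>\<close> to the block \<open>([0], [0], 0)\<close> yields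
  windows in which \<open>u\<close> and \<open>v\<close> coincide everywhere, while the block \<open>([0], [0], 1)\<close> yields windows
  in which \<open>\<theta>\<^sup>n(0)\<close> lies above its own shift by one column and so mismatches at every letter change
  of \<open>\<theta>\<^sup>n(0)\<close>; by primitivity these changes have positive density. Both families of windows make
  up a fixed proportion of the prefixes that they end, so a coincidence density would have to be
  both equal to and less than \<open>1\<close>.
\<close>

subsection \<open>Densities on windows\<close>

text \<open>Convergence says that \<open>C n\<close> is \<open>d * n\<close> up to an error o(n).
  The increment over a window is then \<open>d * L k\<close> up to o(\<open>P k + L k\<close>), and
  the bound on \<open>P k\<close> turns this into o(\<open>L k\<close>). Both families of windows
  are measured this way.\<close>

lemma window_density:
  fixes C :: "nat \<Rightarrow> real" and P L :: "nat \<Rightarrow> nat"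
  assumes C: "(\<lambda>n. C n / real n) \<longlonglongrightarrow> d"
    and PL: "\<And>k. P k \<le> K * L k"
    and L: "filterlim L at_top sequentially"
  shows "(\<lambda>k. (C (P k + L k) - C (P k)) / real (L k)) \<longlonglongrightarrow> d"
proof (rule LIMSEQ_I)
  fix r :: real assume r: "0 < r"
  define e where "e n = \<bar>C n - d * real n\<bar>" for n
  \<comment> \<open>Chosen so that the linear error at the two ends of a window is at most half of
    \<open>r * L k\<close>; the other half absorbs the constant \<open>2 * E\<close>.\<close>
  define \<epsilon> where "\<epsilon> = r / (2 * (2 * real K + 1))"
  have eps: "0 < \<epsilon>" unfolding \<epsilon>_def using r by simp
  obtain n0 where n0: "\<And>n. n \<ge> n0 \<Longrightarrow> \<bar>C n / real n - d\<bar> < \<epsilon>"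
    using LIMSEQ_D[OF C eps] by auto
  \<comment> \<open>The sum dominates the finitely many uncontrolled errors, so that
    \<open>e n \<le> \<epsilon> * n + E\<close> holds for every \<open>n\<close>, including small
    window starts.\<close>
  define E where "E = (\<Sum>n\<le>n0. e n)"
  have e_nonneg: "0 \<le> e n" for n unfolding e_def by simp
  have E_nonneg: "0 \<le> E" unfolding E_def by (intro sum_nonneg) (rule e_nonneg)
  have e_le: "e n \<le> \<epsilon> * real n + E" for n
  proof (cases "n \<le> n0")
    case True
    then have "e n \<le> E"
      unfolding E_def by (intro member_le_sum) (auto simp: e_nonneg)
    then show ?thesis using eps by (smt (verit) mult_nonneg_nonneg of_nat_0_le_iff)
  next
    case False
    then have n: "0 < real n" by simp
    have "C n - d * real n = (C n / real n - d) * real n" using n by (simp add: field_simps)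
    then have "e n = \<bar>C n / real n - d\<bar> * real n" unfolding e_def by (simp add: abs_mult)
    also have "\<dots> \<le> \<epsilon> * real n"
      using n0[of n] False by (intro mult_right_mono) auto
    finally show ?thesis using E_nonneg by linarith
  qed
  obtain k0 where k0: "\<And>k. k \<ge> k0 \<Longrightarrow> nat \<lceil>4 * E / r\<rceil> + 1 \<le> L k"
    using L unfolding filterlim_at_top eventually_sequentially by blast
  show "\<exists>k0. \<forall>k\<ge>k0. norm ((C (P k + L k) - C (P k)) / real (L k) - d) < r"
  proof (intro exI allI impI)
    fix k assume "k0 \<le> k"
    then have Lk: "nat \<lceil>4 * E / r\<rceil> + 1 \<le> L k" by (rule k0)
    then have lpos: "0 < real (L k)" by simp
    have "4 * E / r < real (L k)" using Lk by linarith
    then have EL: "4 * E < r * real (L k)" using r by (simp add: field_simps)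
    have PK: "real (P k) \<le> real K * real (L k)"
      using PL[of k] by (metis of_nat_le_iff of_nat_mult)
    have "\<bar>(C (P k + L k) - C (P k)) - d * real (L k)\<bar> \<le> e (P k + L k) + e (P k)"
      unfolding e_def by (simp add: algebra_simps)
    also have "\<dots> \<le> \<epsilon> * (2 * real (P k) + real (L k)) + 2 * E"
      using e_le[of "P k + L k"] e_le[of "P k"] by (simp add: algebra_simps)
    also have "\<dots> \<le> \<epsilon> * ((2 * real K + 1) * real (L k)) + 2 * E"
      using PK eps by (intro add_right_mono mult_left_mono) (auto simp: algebra_simps)
    also have "\<dots> = r / 2 * real (L k) + 2 * E"
      unfolding \<epsilon>_def by (simp add: field_simps)
    also have "\<dots> < r * real (L k)" using EL by simp
    finally have less: "\<bar>(C (P k + L k) - C (P k)) - d * real (L k)\<bar> < r * real (L k)" .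
    have "(C (P k + L k) - C (P k)) / real (L k) - d
        = ((C (P k + L k) - C (P k)) - d * real (L k)) / real (L k)"
      using lpos by (simp add: field_simps)
    then show "norm ((C (P k + L k) - C (P k)) / real (L k) - d) < r"
      using less lpos by (simp add: pos_divide_less_eq)
  qed
qed

subsection \<open>Letter changes in a word\<close>

text \<open>This is the number of mismatches between a word and its own shift by one column, counted
  where both are defined.\<close>

definition changes :: "'a list \<Rightarrow> nat" where
  "changes x = card {j. Suc j < length x \<and> x ! j \<noteq> x ! Suc j}"

lemma finite_changes: "finite {j. Suc j < length x \<and> P j}"
  by (rule finite_subset[of _ "{..<length x}"]) auto

text \<open>The changes of \<open>y\<close>, moved by the length of \<open>x\<close>, are disjoint
  from those of \<open>x\<close>. Only a possible change at the seam is lost.\<close>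

lemma changes_append: "changes x + changes y \<le> changes (x @ y)"
proof -
  let ?S = "\<lambda>x. {j. Suc j < length x \<and> x ! j \<noteq> x ! Suc j}"
  have sub: "?S x \<union> (+) (length x) ` ?S y \<subseteq> ?S (x @ y)"
    by (auto simp: nth_append)
  have "card (?S x \<union> (+) (length x) ` ?S y) = card (?S x) + card ((+) (length x) ` ?S y)"
    by (rule card_Un_disjoint) (auto simp: finite_changes)
  also have "card ((+) (length x) ` ?S y) = card (?S y)"
    by (rule card_image) auto
  finally show ?thesis
    unfolding changes_def using card_mono[OF finite_changes sub] by linarith
qed

lemma changes_pos:
  assumes "a \<in> set x" "b \<in> set x" "a \<noteq> b"
  shows "0 < changes x"
proof (rule ccontr)
  assume "\<not> 0 < changes x"
  then have eq: "x ! j = x ! Suc j" if "Suc j < length x" for j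
    using that finite_changes[of x] unfolding changes_def by auto
  have all: "x ! j = x ! 0" if "j < length x" for j
    using that
  proof (induction j)
    case (Suc j)
    then show ?case using eq[of j] by simp
  qed simp
  then show False using assms by (metis in_set_conv_nth)
qed

lemma changes_concat:
  assumes "\<And>y. y \<in> set ys \<Longrightarrow> 0 < changes y"
  shows "length ys \<le> changes (concat ys)"
  using assms
proof (induction ys)
  case (Cons y ys)
  have "0 < changes y" and "length ys \<le> changes (concat ys)" using Cons by auto
  then show ?case using changes_append[of y "concat ys"] by simp
qed simp

subsection \<open>Iterated substitutions\<close>

abbreviation iter_subst :: "(nat \<Rightarrow> nat list) \<Rightarrow> nat \<Rightarrow> nat list \<Rightarrow> nat list" where
  "iter_subst \<theta> n \<equiv> subst_word \<theta> ^^ n"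

lemma subst_word_simps [simp]:
  "subst_word \<theta> [] = []"
  "subst_word \<theta> (a # x) = \<theta> a @ subst_word \<theta> x"
  "subst_word \<theta> (x @ y) = subst_word \<theta> x @ subst_word \<theta> y"
  by (simp_all add: subst_word_def)

lemma iter_subst_Nil [simp]: "iter_subst \<theta> n [] = []"
  by (induction n) auto

lemma iter_subst_append [simp]:
  "iter_subst \<theta> n (x @ y) = iter_subst \<theta> n x @ iter_subst \<theta> n y"
  by (induction n) auto

lemma iter_subst_concat: "iter_subst \<theta> n x = concat (map (\<lambda>a. iter_subst \<theta> n [a]) x)"
proof (induction x)
  case (Cons a x)
  then show ?case using iter_subst_append[of n \<theta> "[a]" x] by simp
qed simp

lemma iter_subst_add: "iter_subst \<theta> (m + n) x = iter_subst \<theta> m (iter_subst \<theta> n x)"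
  by (simp add: funpow_add)

lemma length_iter_subst_le:
  assumes "\<And>a. a \<in> set x \<Longrightarrow> length (iter_subst \<theta> n [a]) \<le> B"
  shows "length (iter_subst \<theta> n x) \<le> length x * B"
  using assms
proof (induction x)
  case (Cons a x)
  have "length (iter_subst \<theta> n [a]) \<le> B" "length (iter_subst \<theta> n x) \<le> length x * B"
    using Cons by auto
  then show ?case using iter_subst_append[of n \<theta> "[a]" x] by simp
qed simp

lemma length_iter_subst_ge:
  assumes "\<And>a. a \<in> set x \<Longrightarrow> B \<le> length (iter_subst \<theta> n [a])"
  shows "length x * B \<le> length (iter_subst \<theta> n x)"
  using assms
proof (induction x)
  case (Cons a x)
  have "B \<le> length (iter_subst \<theta> n [a])" "length x * B \<le> length (iter_subst \<theta> n x)"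
    using Cons by auto
  then show ?case using iter_subst_append[of n \<theta> "[a]" x] by simp
qed simp

lemma length_iter_subst_mem_le:
  assumes "a \<in> set x"
  shows "length (iter_subst \<theta> n [a]) \<le> length (iter_subst \<theta> n x)"
proof -
  obtain y z where "x = y @ [a] @ z" using assms by (metis split_list append_Cons append_Nil)
  then show ?thesis by (simp del: append_Cons)
qed

lemma prefix_nth: "prefix x y \<Longrightarrow> k < length x \<Longrightarrow> x ! k = y ! k"
  by (auto simp: prefix_def nth_append)

lemma count_list_subst_word:
  assumes "set x \<subseteq> {0, 1}"
  shows "count_list (subst_word \<theta> x) j
    = count_list x 0 * count_list (\<theta> 0) j + count_list x 1 * count_list (\<theta> 1) j"
  using assms by (induction x) auto

lemma length_conv_count_list:
  fixes x :: "nat list"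
  assumes "set x \<subseteq> {0, 1}"
  shows "length x = count_list x 0 + count_list x 1"
  using assms by (induction x) auto

context
  fixes \<theta> :: "nat \<Rightarrow> nat list"
  assumes subst: "substitution \<theta>"
begin

lemma set_iter_subst: "set x \<subseteq> {0, 1} \<Longrightarrow> set (iter_subst \<theta> n x) \<subseteq> {0, 1}"
proof (induction n)
  case (Suc n)
  have "set (\<theta> a) \<subseteq> {0, 1}" if "a \<in> {0, 1}" for a
    using subst that unfolding substitution_def by blast
  then have "set (subst_word \<theta> y) \<subseteq> {0, 1}" if "set y \<subseteq> {0, 1}" for y
    using that unfolding subst_word_def set_concat set_map by blast
  then show ?case using Suc by simp
qed simp

text \<open>Letter counts are row vectors here: applying \<theta> once more to a word multiplies its
  count vector by the matrix on the right. This turns primitivity into a statement about letters of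
  iterates.\<close>

lemma subst_mat_pow:
  assumes "i < 2" "j < 2"
  shows "(subst_mat \<theta> ^\<^sub>m n) $$ (i, j) = count_list (iter_subst \<theta> n [i]) j"
  using assms(2)
proof (induction n arbitrary: j)
  case 0
  then show ?case using assms(1) by (auto simp: subst_mat_def)
next
  case (Suc n)
  have M: "subst_mat \<theta> \<in> carrier_mat 2 2" unfolding subst_mat_def by simp
  then have Mn: "subst_mat \<theta> ^\<^sub>m n \<in> carrier_mat 2 2" by (rule pow_carrier_mat)
  have two: "{0..<2::nat} = {0, 1}" by auto
  have i: "set [i] \<subseteq> {0, 1}" using assms(1) by auto
  have "(subst_mat \<theta> ^\<^sub>m Suc n) $$ (i, j)
      = (\<Sum>l\<in>{0..<2}. (subst_mat \<theta> ^\<^sub>m n) $$ (i, l) * subst_mat \<theta> $$ (l, j))"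
    using M Mn assms(1) Suc.prems by (simp add: scalar_prod_def)
  also have "\<dots> = (\<Sum>l\<in>{0..<2}. count_list (iter_subst \<theta> n [i]) l * count_list (\<theta> l) j)"
    using Suc by (intro sum.cong) (auto simp: subst_mat_def)
  also have "\<dots> = count_list (iter_subst \<theta> (Suc n) [i]) j"
    using count_list_subst_word[OF set_iter_subst[OF i]] two by simp
  finally show ?case .
qed

section \<open>Fixed points as limits of nested prefixes\<close>

lemma prefix_iter_subst:
  assumes "a \<in> {0, 1}" "hd (\<theta> a) = a" "m \<le> n"
  shows "prefix (iter_subst \<theta> m [a]) (iter_subst \<theta> n [a])"
proof -
  have "\<theta> a \<noteq> []" using subst assms(1) unfolding substitution_def by blast
  then have a: "\<theta> a = [a] @ tl (\<theta> a)" using assms(2) by (cases "\<theta> a") auto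
  have step: "prefix (iter_subst \<theta> k [a]) (iter_subst \<theta> (Suc k) [a])" for k
  proof -
    \<comment> \<open>Peeling off the innermost application and using that the image of
      \<open>a\<close> starts with \<open>a\<close> exhibits the previous iterate as a
      prefix.\<close>
    have "iter_subst \<theta> (Suc k) [a] = iter_subst \<theta> k (\<theta> a)"
      by (simp only: funpow_Suc_right) simp
    also have "\<dots> = iter_subst \<theta> k [a] @ iter_subst \<theta> k (tl (\<theta> a))"
      by (subst a, subst iter_subst_append) (rule refl)
    finally show ?thesis by simp
  qed
  show ?thesis using assms(3)
    by (induction rule: dec_induct) (simp, blast intro: prefix_order.trans step)
qed

lemma subst_limit_nth:
  assumes "a \<in> {0, 1}" "hd (\<theta> a) = a" "k < length (iter_subst \<theta> n [a])"
  shows "subst_limit \<theta> a k = iter_subst \<theta> n [a] ! k"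
proof -
  have *: "k < length (iter_subst \<theta> m [a]) \<and> iter_subst \<theta> m [a] ! k = iter_subst \<theta> n [a] ! k"
    if "n \<le> m" for m
    using prefix_iter_subst[OF assms(1,2) that] assms(3) prefix_length_le prefix_nth
    by (metis order_less_le_trans)
  show ?thesis unfolding subst_limit_def
  proof (rule the_equality)
    show "\<forall>\<^sub>F m in sequentially. k < length (iter_subst \<theta> m [a])
        \<and> iter_subst \<theta> m [a] ! k = iter_subst \<theta> n [a] ! k"
      using * unfolding eventually_sequentially by blast
    fix c assume "\<forall>\<^sub>F m in sequentially. k < length (iter_subst \<theta> m [a])
        \<and> iter_subst \<theta> m [a] ! k = c"
    then obtain N where "\<And>m. N \<le> m \<Longrightarrow> iter_subst \<theta> m [a] ! k = c"
      unfolding eventually_sequentially by blast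
    then show "c = iter_subst \<theta> n [a] ! k" using *[of "max n N"] by auto
  qed
qed

text \<open>A finite form of the fixed point equation: a prefix of \<open>f\<close> is a prefix of
  the \<open>k\<close>-th iterate of \<open>a\<close> for some \<open>k\<close>, so its image is a
  prefix of the \<open>n + k\<close>-th iterate and hence of \<open>f\<close>.\<close>

lemma iter_subst_prefix_of_limit:
  assumes "a \<in> {0, 1}" "hd (\<theta> a) = a"
    and unb: "filterlim (\<lambda>n. length (iter_subst \<theta> n [a])) at_top sequentially"
  defines "f \<equiv> subst_limit \<theta> a"
  shows "iter_subst \<theta> n (map f [0..<p]) = map f [0..<length (iter_subst \<theta> n (map f [0..<p]))]"
proof -
  obtain k where k: "p \<le> length (iter_subst \<theta> k [a])"
    using unb unfolding filterlim_at_top eventually_sequentially by blast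
  have lim: "take q (iter_subst \<theta> i [a]) = map f [0..<q]" if "q \<le> length (iter_subst \<theta> i [a])" for q i
    using that subst_limit_nth[OF assms(1,2), of _ i] unfolding f_def by (intro nth_equalityI) auto
  let ?x = "map f [0..<p]"
  have "prefix ?x (iter_subst \<theta> k [a])"
    using lim[OF k] take_is_prefix by metis
  then obtain y where "iter_subst \<theta> k [a] = ?x @ y" by (auto simp: prefix_def)
  then have "iter_subst \<theta> (n + k) [a] = iter_subst \<theta> n ?x @ iter_subst \<theta> n y"
    unfolding iter_subst_add by simp
  then have "take (length (iter_subst \<theta> n ?x)) (iter_subst \<theta> (n + k) [a]) = iter_subst \<theta> n ?x"
    and "length (iter_subst \<theta> n ?x) \<le> length (iter_subst \<theta> (n + k) [a])" by auto
  then show ?thesis using lim by metis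
qed

lemma subst_limit_range:
  assumes "a \<in> {0, 1}" "hd (\<theta> a) = a"
    and unb: "filterlim (\<lambda>n. length (iter_subst \<theta> n [a])) at_top sequentially"
  shows "subst_limit \<theta> a k \<in> {0, 1}"
proof -
  obtain n where "Suc k \<le> length (iter_subst \<theta> n [a])"
    using unb unfolding filterlim_at_top eventually_sequentially by blast
  then have k: "k < length (iter_subst \<theta> n [a])" by simp
  have "set (iter_subst \<theta> n [a]) \<subseteq> {0, 1}" using assms(1) by (intro set_iter_subst) auto
  then show ?thesis using subst_limit_nth[OF assms(1,2) k] k nth_mem by fastforce
qed

text \<open>The images of the prefixes of lengths \<open>p\<close> and \<open>Suc p\<close> are both
  prefixes of \<open>f\<close>, and they differ exactly by the image of the letter \<open>b\<close>
  at position \<open>p\<close>.\<close>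

lemma subst_limit_window:
  assumes "a \<in> {0, 1}" "hd (\<theta> a) = a"
    and unb: "filterlim (\<lambda>n. length (iter_subst \<theta> n [a])) at_top sequentially"
    and j: "j < length (iter_subst \<theta> n [b])"
  defines "f \<equiv> subst_limit \<theta> a"
  assumes b: "f p = b"
  shows "f (length (iter_subst \<theta> n (map f [0..<p])) + j) = iter_subst \<theta> n [b] ! j"
proof -
  note fixed = iter_subst_prefix_of_limit[OF assms(1-3), folded f_def]
  let ?x = "iter_subst \<theta> n (map f [0..<p])" and ?y = "iter_subst \<theta> n (map f [0..<Suc p])"
  have y: "?y = ?x @ iter_subst \<theta> n [b]" using b by simp
  then have len: "length ?x + j < length ?y" using j by simp
  then have "f (length ?x + j) = map f [0..<length ?y] ! (length ?x + j)" by simp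
  also have "\<dots> = ?y ! (length ?x + j)" using fixed[of n "Suc p"] by simp
  also have "\<dots> = iter_subst \<theta> n [b] ! j" unfolding y by (simp add: nth_append)
  finally show ?thesis .
qed


section \<open>Growth and letter changes of the iterates under primitivity\<close>

lemma length_iter_subst_mono:
  assumes "set x \<subseteq> {0, 1}" "m \<le> n"
  shows "length (iter_subst \<theta> m x) \<le> length (iter_subst \<theta> n x)"
proof -
  have ne: "\<theta> a \<noteq> []" if "a \<in> {0, 1}" for a
    using subst that unfolding substitution_def by blast
  have "length y \<le> length (subst_word \<theta> y)" if "set y \<subseteq> {0, 1}" for y
    using that
  proof (induction y)
    case (Cons a y)
    then have "Suc 0 \<le> length (\<theta> a)" and "length y \<le> length (subst_word \<theta> y)"
      using ne[of a] by (simp_all add: Suc_le_eq)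
    then show ?case by simp
  qed simp
  then have step: "length (iter_subst \<theta> k x) \<le> length (iter_subst \<theta> (Suc k) x)" for k
    using set_iter_subst[OF assms(1)] by simp
  show ?thesis by (rule lift_Suc_mono_le[of "\<lambda>k. length (iter_subst \<theta> k x)", OF step assms(2)])
qed

lemma primitive_subst_letters:
  assumes "primitive_subst \<theta>"
  obtains m where "\<And>a. a \<in> {0, 1} \<Longrightarrow> {0, 1} \<subseteq> set (iter_subst \<theta> m [a])"
proof -
  obtain m where m: "\<And>i j. i < 2 \<Longrightarrow> j < 2 \<Longrightarrow> 0 < (subst_mat \<theta> ^\<^sub>m m) $$ (i, j)"
    using assms unfolding primitive_subst_def by blast
  have "j \<in> set (iter_subst \<theta> m [i])" if "i < 2" "j < 2" for i j
    using m[OF that] subst_mat_pow[OF that] count_list_0_iff by force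
  then show thesis by (intro that[of m]) auto
qed

text \<open>Each letter has an \<open>m\<close>-th iterate containing two distinct letters, so every
  \<open>m\<close> steps at least double the length; in between, lengths do not decrease.\<close>

lemma length_iter_subst_at_top:
  assumes m: "\<And>a. a \<in> {0, 1} \<Longrightarrow> {0, 1} \<subseteq> set (iter_subst \<theta> m [a])"
    and a: "a \<in> {0, 1}"
  shows "filterlim (\<lambda>n. length (iter_subst \<theta> n [a])) at_top sequentially"
proof -
  have two: "2 \<le> length (iter_subst \<theta> m [b])" if "b \<in> {0, 1}" for b
    using card_mono[OF _ m[OF that]] card_length[of "iter_subst \<theta> m [b]"] by fastforce
  have set_a: "set [a] \<subseteq> {0, 1}" using a by simp
  have pow: "2 ^ k \<le> length (iter_subst \<theta> (k * m) [a])" for k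
  proof (induction k)
    case (Suc k)
    have "length (iter_subst \<theta> (k * m) [a]) * 2
        \<le> length (iter_subst \<theta> m (iter_subst \<theta> (k * m) [a]))"
      using set_iter_subst[OF set_a] by (intro length_iter_subst_ge two) blast
    then show ?case using Suc by (simp add: iter_subst_add)
  qed simp
  show ?thesis unfolding filterlim_at_top eventually_sequentially
  proof (intro allI exI impI)
    fix Z n assume n: "Z * m \<le> n"
    have "Z \<le> 2 ^ Z" by simp
    also have "\<dots> \<le> length (iter_subst \<theta> (Z * m) [a])" by (rule pow)
    also have "\<dots> \<le> length (iter_subst \<theta> n [a])" by (rule length_iter_subst_mono[OF set_a n])
    finally show "Z \<le> length (iter_subst \<theta> n [a])" .
  qed
qed

text \<open>Every letter of \<open>x\<close> yields a block containing both letters, hence a change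
  inside that block. This gives changes a positive density.\<close>

lemma changes_iter_subst:
  assumes m: "\<And>a. a \<in> {0, 1} \<Longrightarrow> {0, 1} \<subseteq> set (iter_subst \<theta> m [a])"
    and x: "set x \<subseteq> {0, 1}"
  shows "length x \<le> changes (iter_subst \<theta> m x)"
proof -
  have "0 < changes (iter_subst \<theta> m [a])" if "a \<in> set x" for a
  proof (rule changes_pos[of 0 _ 1])
    show "0 \<in> set (iter_subst \<theta> m [a])" "1 \<in> set (iter_subst \<theta> m [a])"
      using m[of a] that x by auto
  qed simp
  then show ?thesis
    unfolding iter_subst_concat[of m \<theta> x]
    using changes_concat[of "map (\<lambda>a. iter_subst \<theta> m [a]) x"] by auto
qed

subsection \<open>The second eigenvalue acts on slopes\<close>

lemma det_2:
  fixes A :: "'a :: comm_ring_1 mat"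
  assumes "A \<in> carrier_mat 2 2"
  shows "det A = A $$ (0, 0) * A $$ (1, 1) - A $$ (0, 1) * A $$ (1, 0)"
proof -
  have two: "{..<2::nat} = {0, 1}" by auto
  show ?thesis
    using assms by (simp add: laplace_expansion_row[OF assms, of 0] two cofactor_def
        det_single mat_delete_def)
qed

text \<open>In dimension two, the row vectors orthogonal to \<open>w\<close> form a line that the
  matrix preserves, acting on it by the second eigenvalue \<kappa>. Count differences of words of
  equal weight lie on this line, and a length difference is the sum of the two entries.\<close>

lemma salem_slope:
  assumes salem: "salem_type \<theta>" and w: "pf_right_eigenvector \<theta> w"
  obtains \<kappa> :: real where "\<kappa>\<^sup>2 = 1"
    "\<And>x y n. \<lbrakk>set x \<subseteq> {0, 1}; set y \<subseteq> {0, 1}; letter_counts x \<bullet> w = letter_counts y \<bullet> w\<rbrakk> \<Longrightarrow>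
      real (length (iter_subst \<theta> n x)) - real (length (iter_subst \<theta> n y))
        = \<kappa> ^ n * (real (length x) - real (length y))"
proof -
  define \<rho> where "\<rho> = pf_eigenvalue \<theta>"
  define a b c d where "a = real (count_list (\<theta> 0) 0)" and "b = real (count_list (\<theta> 0) 1)"
    and "c = real (count_list (\<theta> 1) 0)" and "d = real (count_list (\<theta> 1) 1)"
  \<comment> \<open>The second eigenvalue, read off from the trace.\<close>
  define \<kappa> where "\<kappa> = a + d - \<rho>"
  let ?M = "map_mat of_nat (subst_mat \<theta>) :: real mat"
  have two: "{0..<2::nat} = {0, 1}" by auto
  have w0: "0 < w $ 0" and w1: "0 < w $ 1" and wc: "w \<in> carrier_vec 2"
    and eig: "?M *\<^sub>v w = \<rho> \<cdot>\<^sub>v w"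
    using w unfolding pf_right_eigenvector_def eigenvector_def \<rho>_def by (auto simp: subst_mat_def)
  have row0: "a * w $ 0 + b * w $ 1 = \<rho> * w $ 0"
    using arg_cong[OF eig, of "\<lambda>v. v $ 0"] wc two
    by (simp add: subst_mat_def scalar_prod_def a_def b_def)
  have row1: "c * w $ 0 + d * w $ 1 = \<rho> * w $ 1"
    using arg_cong[OF eig, of "\<lambda>v. v $ 1"] wc two
    by (simp add: subst_mat_def scalar_prod_def c_def d_def)
  \<comment> \<open>This is the characteristic equation at \<rho>, obtained by multiplying the two
    rows of the eigenvector equation and cancelling \<open>w $ 0 * w $ 1\<close>.\<close>
  have bc: "b * c = (\<rho> - a) * (\<rho> - d)"
  proof -
    have "b * w $ 1 = (\<rho> - a) * w $ 0" and "c * w $ 0 = (\<rho> - d) * w $ 1"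
      using row0 row1 by (simp_all add: algebra_simps)
    then have "(b * w $ 1) * (c * w $ 0) = ((\<rho> - a) * w $ 0) * ((\<rho> - d) * w $ 1)"
      by (rule arg_cong2)
    then have "(b * c) * (w $ 0 * w $ 1) = ((\<rho> - a) * (\<rho> - d)) * (w $ 0 * w $ 1)"
      by (simp add: mult_ac)
    then show ?thesis using w0 w1 by simp
  qed
  have kappa: "\<kappa>\<^sup>2 = 1"
  proof -
    obtain \<mu> where spec: "spectrum (subst_cmat \<theta>) = {of_real \<rho>, \<mu>}" and mu: "cmod \<mu> = 1"
      using salem unfolding salem_type_def \<rho>_def by blast
    have M: "subst_cmat \<theta> \<in> carrier_mat 2 2" by (simp add: subst_mat_def)
    have "e \<in> spectrum (subst_cmat \<theta>) \<longleftrightarrow> e = of_real \<rho> \<or> e = of_real \<kappa>" for e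
    proof -
      have "det (char_matrix (subst_cmat \<theta>) e)
          = (of_real a - e) * (of_real d - e) - of_real (b * c)"
        by (subst det_2) (simp_all add: char_matrix_def subst_mat_def a_def b_def c_def d_def)
      also have "\<dots> = (e - of_real \<rho>) * (e - of_real \<kappa>)"
        unfolding bc \<kappa>_def by (simp add: algebra_simps)
      finally show ?thesis
        unfolding spectrum_def using eigenvalue_det[OF M, of e] by simp
    qed
    \<comment> \<open>Two pairs sharing one entry agree in the other, even when the entries
      coincide. Thus \<mu> is the real number \<kappa>, and modulus one gives \<kappa> = 1 or
      \<kappa> = -1.\<close>
    then have "{of_real \<rho>, of_real \<kappa>} = {of_real \<rho>, \<mu>}" unfolding spec[symmetric] by blast
    then have "of_real \<kappa> = \<mu>" by (metis doubleton_eq_iff)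
    then have "\<bar>\<kappa>\<bar> = 1" using mu by (metis norm_of_real)
    then show ?thesis by (simp add: abs_square_eq_1)
  qed
  \<comment> \<open>A row vector orthogonal to \<open>w\<close> is a left eigenvector for \<kappa>.
    Each coordinate is multiplied by an entry of \<open>w\<close> so that \<open>row0\<close> and
    \<open>row1\<close> can eliminate \<open>c\<close> and \<open>b\<close>.\<close>
  have kc: "w $ 0 * x0 = - (w $ 1 * x1) \<Longrightarrow> x0 * a + x1 * c = \<kappa> * x0"
    and kd: "w $ 0 * x0 = - (w $ 1 * x1) \<Longrightarrow> x0 * b + x1 * d = \<kappa> * x1" for x0 x1
  proof -
    assume x: "w $ 0 * x0 = - (w $ 1 * x1)"
    have "w $ 0 * (x0 * a + x1 * c) = a * (w $ 0 * x0) + x1 * (c * w $ 0)"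
      by (simp add: algebra_simps)
    also have "c * w $ 0 = (\<rho> - d) * w $ 1" using row1 by (simp add: algebra_simps)
    also have "a * (w $ 0 * x0) + x1 * ((\<rho> - d) * w $ 1)
        = a * (w $ 0 * x0) - (\<rho> - d) * (w $ 0 * x0)"
      unfolding x by (simp add: algebra_simps)
    also have "\<dots> = w $ 0 * (\<kappa> * x0)" unfolding \<kappa>_def by (simp add: algebra_simps)
    finally have "w $ 0 * (x0 * a + x1 * c) = w $ 0 * (\<kappa> * x0)" .
    then show "x0 * a + x1 * c = \<kappa> * x0" using w0 by simp
    have x': "w $ 1 * x1 = - (w $ 0 * x0)" using x by simp
    have "w $ 1 * (x0 * b + x1 * d) = x0 * (b * w $ 1) + d * (w $ 1 * x1)"
      by (simp add: algebra_simps)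
    also have "b * w $ 1 = (\<rho> - a) * w $ 0" using row0 by (simp add: algebra_simps)
    also have "x0 * ((\<rho> - a) * w $ 0) + d * (w $ 1 * x1)
        = - (\<rho> - a) * (w $ 1 * x1) + d * (w $ 1 * x1)"
      unfolding x' by (simp add: algebra_simps)
    also have "\<dots> = w $ 1 * (\<kappa> * x1)" unfolding \<kappa>_def by (simp add: algebra_simps)
    finally have "w $ 1 * (x0 * b + x1 * d) = w $ 1 * (\<kappa> * x1)" .
    then show "x0 * b + x1 * d = \<kappa> * x1" using w1 by simp
  qed
  have counts: "real (count_list (iter_subst \<theta> n x) 0) - real (count_list (iter_subst \<theta> n y) 0)
        = \<kappa> ^ n * (real (count_list x 0) - real (count_list y 0))
      \<and> real (count_list (iter_subst \<theta> n x) 1) - real (count_list (iter_subst \<theta> n y) 1)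
        = \<kappa> ^ n * (real (count_list x 1) - real (count_list y 1))"
    if x: "set x \<subseteq> {0, 1}" and y: "set y \<subseteq> {0, 1}"
      and xy: "letter_counts x \<bullet> w = letter_counts y \<bullet> w" for x y n
  proof (induction n)
    case (Suc n)
    let ?d = "\<lambda>j. real (count_list (iter_subst \<theta> n x) j) - real (count_list (iter_subst \<theta> n y) j)"
    have "w $ 0 * (real (count_list x 0) - real (count_list y 0))
        = - (w $ 1 * (real (count_list x 1) - real (count_list y 1)))"
      using xy unfolding letter_counts_scalar[OF wc] by (simp add: algebra_simps)
    \<comment> \<open>By the induction hypothesis the current difference is a multiple of the
      initial one, so it stays orthogonal to \<open>w\<close>.\<close>
    then have orth: "w $ 0 * ?d 0 = - (w $ 1 * ?d 1)"
      using Suc by (metis mult.left_commute mult_minus_right)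
    note count = count_list_subst_word[OF set_iter_subst[OF x]]
      count_list_subst_word[OF set_iter_subst[OF y]]
    have "real (count_list (iter_subst \<theta> (Suc n) x) 0) - real (count_list (iter_subst \<theta> (Suc n) y) 0)
        = ?d 0 * a + ?d 1 * c"
      by (simp add: count a_def c_def algebra_simps)
    also have "\<dots> = \<kappa> * ?d 0" by (rule kc[OF orth])
    finally have 0: "real (count_list (iter_subst \<theta> (Suc n) x) 0)
      - real (count_list (iter_subst \<theta> (Suc n) y) 0) = \<kappa> * ?d 0" .
    have "real (count_list (iter_subst \<theta> (Suc n) x) 1) - real (count_list (iter_subst \<theta> (Suc n) y) 1)
        = ?d 0 * b + ?d 1 * d"
      by (simp add: count b_def d_def algebra_simps)
    also have "\<dots> = \<kappa> * ?d 1" by (rule kd[OF orth])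
    finally have 1: "real (count_list (iter_subst \<theta> (Suc n) x) 1)
      - real (count_list (iter_subst \<theta> (Suc n) y) 1) = \<kappa> * ?d 1" .
    show ?case unfolding 0 1 using Suc by simp
  qed simp
  show thesis
  proof (rule that[OF kappa])
    fix x y n assume xy: "set x \<subseteq> {0, 1}" "set y \<subseteq> {0, 1}"
      "letter_counts x \<bullet> w = letter_counts y \<bullet> w"
    note len = length_conv_count_list[OF xy(1)] length_conv_count_list[OF xy(2)]
      length_conv_count_list[OF set_iter_subst[OF xy(1)]]
      length_conv_count_list[OF set_iter_subst[OF xy(2)]]
    show "real (length (iter_subst \<theta> n x)) - real (length (iter_subst \<theta> n y))
        = \<kappa> ^ n * (real (length x) - real (length y))"
      using counts[OF xy, of n] unfolding len of_nat_add by (simp add: algebra_simps)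
  qed
qed

end

subsection \<open>Coincidences\<close>

lemma card_window:
  fixes P L :: nat
  shows "real (card {k. k < P + L \<and> Q k}) - real (card {k. k < P \<and> Q k})
    = real (card {j. j < L \<and> Q (P + j)})"
proof -
  have eq: "{k. k < P + L \<and> Q k} = {k. k < P \<and> Q k} \<union> (+) P ` {j. j < L \<and> Q (P + j)}"
  proof (intro equalityI subsetI)
    fix k assume k: "k \<in> {k. k < P + L \<and> Q k}"
    show "k \<in> {k. k < P \<and> Q k} \<union> (+) P ` {j. j < L \<and> Q (P + j)}"
    proof (cases "k < P")
      case False
      then have "k = P + (k - P)" "k - P \<in> {j. j < L \<and> Q (P + j)}" using k by auto
      then show ?thesis by blast
    qed (use k in simp)
  qed auto
  have "card {k. k < P + L \<and> Q k}
      = card {k. k < P \<and> Q k} + card ((+) P ` {j. j < L \<and> Q (P + j)})"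
    unfolding eq by (rule card_Un_disjoint) auto
  also have "card ((+) P ` {j. j < L \<and> Q (P + j)}) = card {j. j < L \<and> Q (P + j)}"
    by (rule card_image) auto
  finally show ?thesis by simp
qed

text \<open>A one-letter block is reduced to what the windows grow from: the cut at its left end and
  the two letters that start there.\<close>

lemma decomposition_blocks_cut:
  assumes "([a], [b], s) \<in> decomposition_blocks w u v"
  obtains p q where "is_cut w u v p q" "u p = a" "v q = b" "int p - int q = s"
proof -
  have first: "f p = c" if "[c] = map f [p..<p']" for f :: "nat \<Rightarrow> nat" and c p p'
    using that by (cases "p < p'") (auto simp: upt_conv_Cons)
  obtain p q p' q' where "[a] = map u [p..<p']" "[b] = map v [q..<q']" "s = int p - int q"
    and "is_cut w u v p q"
    using assms unfolding decomposition_blocks_def consecutive_cuts_def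
    by (elim CollectE exE conjE Pair_inject)
  then show thesis using that first by metis
qed

section \<open>Coinciding and shifted windows\<close>

theorem theorem1:
  fixes \<theta> :: "nat \<Rightarrow> nat list" and w :: "real vec" and u v :: "nat \<Rightarrow> nat"
  assumes "substitution \<theta>"
    and "primitive_subst \<theta>"
    and "salem_type \<theta>"
    and "hd (\<theta> 0) = 0"
    and "hd (\<theta> 1) = 1"
    and "pf_right_eigenvector \<theta> w"
    and "u = subst_limit \<theta> 0"
    and "v = subst_limit \<theta> 1"
    and "finite (decomposition_blocks w u v)"
    and "zero_hat \<in> decomposition_blocks w u v"
    and "zero_hat_skewed \<in> decomposition_blocks w u v"
  shows "\<not> convergent (\<lambda>n. real (card {k. k < n \<and> u k = v k}) / real n)"
proof
  note sub = assms(1)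
  assume "convergent (\<lambda>n. real (card {k. k < n \<and> u k = v k}) / real n)"
  then obtain \<delta> where \<delta>: "(\<lambda>n. real (card {k. k < n \<and> u k = v k}) / real n) \<longlonglongrightarrow> \<delta>"
    unfolding convergent_def by blast
  obtain m where m: "\<And>a. a \<in> {0, 1} \<Longrightarrow> {0, 1} \<subseteq> set (iter_subst \<theta> m [a])"
    using primitive_subst_letters[OF sub assms(2)] by blast
  have unb: "filterlim (\<lambda>n. length (iter_subst \<theta> n [a])) at_top sequentially" if "a \<in> {0, 1}" for a
    using length_iter_subst_at_top[OF sub _ that] m by blast
  obtain \<kappa> :: real where \<kappa>: "\<kappa>\<^sup>2 = 1" and slope: "\<And>x y n. \<lbrakk>set x \<subseteq> {0, 1}; set y \<subseteq> {0, 1};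
      letter_counts x \<bullet> w = letter_counts y \<bullet> w\<rbrakk> \<Longrightarrow>
      real (length (iter_subst \<theta> n x)) - real (length (iter_subst \<theta> n y))
        = \<kappa> ^ n * (real (length x) - real (length y))"
    using salem_slope[OF sub assms(3,6)] by blast

  \<comment> \<open>Even powers make the factor \<kappa> ^ (2 * k) equal to 1. The images of a cut
    \<open>(p, q)\<close> start at columns \<open>pu p k\<close> and \<open>pv q k\<close>, and
    \<open>x k\<close> is the word grown there from the letter 0.\<close>
  define x where "x k = iter_subst \<theta> (2 * k) [0]" for k
  define L where "L k = length (x k)" for k
  define pu where "pu p k = length (iter_subst \<theta> (2 * k) (map u [0..<p]))" for p k
  define pv where "pv q k = length (iter_subst \<theta> (2 * k) (map v [0..<q]))" for q k
  \<comment> \<open>One bound for the growth of either letter under the \<open>m\<close>-th iterate.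
    It serves both to compare window starts with window lengths and to bound the density of changes
    from below.\<close>
  define B where "B = length (iter_subst \<theta> m [0]) + length (iter_subst \<theta> m [1])"

  have B0: "0 < real B"
    using m[of 0] length_pos_if_in_set[of 0 "iter_subst \<theta> m [0]"] unfolding B_def
    by (simp add: add_pos_nonneg)
  have letters: "set (map u [0..<p]) \<subseteq> {0, 1}" "set (map v [0..<p]) \<subseteq> {0, 1}" for p
    using subst_limit_range[OF sub _ assms(4) unb] subst_limit_range[OF sub _ assms(5) unb]
    unfolding assms(7,8) set_map image_subset_iff by simp_all
  have u_window: "u (pu p k + j) = x k ! j" if "u p = 0" "j < L k" for p k j
    using subst_limit_window[OF sub _ assms(4) unb, of j "2 * k" 0 p] that
    unfolding pu_def x_def L_def assms(7) by simp
  have v_window: "v (pv q k + j) = x k ! j" if "v q = 0" "j < L k" for q k j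
    using subst_limit_window[OF sub _ assms(5) unb, of j "2 * k" 0 q] that
    unfolding pv_def x_def L_def assms(8) by simp
  have cut_slope: "real (pu p k) - real (pv q k) = real p - real q" if "is_cut w u v p q" for p q k
    using slope[OF letters(1)[of p] letters(2)[of q], of "2 * k"] that
    unfolding is_cut_def pu_def pv_def by (simp add: power_mult \<kappa>)

  have L_lim: "filterlim L at_top sequentially"
  proof -
    have "filterlim (\<lambda>k::nat. 2 * k) at_top sequentially"
      by (rule filterlim_subseq) (simp add: strict_mono_def)
    from filterlim_compose[OF unb[of 0] this] show ?thesis unfolding L_def x_def by simp
  qed
  have B_image: "length (iter_subst \<theta> (m + n) [0]) \<le> length (iter_subst \<theta> n [0]) * B" for n
  proof -
    have "set (iter_subst \<theta> n [0]) \<subseteq> {0, 1}" by (rule set_iter_subst[OF sub]) simp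
    then show ?thesis
      unfolding iter_subst_add by (intro length_iter_subst_le) (auto simp: B_def)
  qed
  have pu_le: "pu p k \<le> p * B * L k" for p k
  proof -
    have "length (iter_subst \<theta> (2 * k) [a]) \<le> L k * B" if a: "a \<in> {0, 1}" for a
    proof -
      \<comment> \<open>Since \<open>a\<close> occurs in the \<open>m\<close>-th iterate of 0, its
        image is a factor of the \<open>m + 2 * k\<close>-th iterate of 0, which has length at most
        \<open>L k * B\<close>.\<close>
      have "a \<in> set (iter_subst \<theta> m [0])" using m[of 0] a by blast
      from length_iter_subst_mem_le[OF this, of "2 * k" \<theta>]
      have "length (iter_subst \<theta> (2 * k) [a]) \<le> length (iter_subst \<theta> (m + 2 * k) [0])"
        unfolding iter_subst_add[symmetric] by (simp add: add.commute)
      also have "\<dots> \<le> L k * B" using B_image unfolding L_def x_def .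
      finally show ?thesis .
    qed
    then have "pu p k \<le> length (map u [0..<p]) * (L k * B)"
      unfolding pu_def using letters(1) by (intro length_iter_subst_le) blast
    then show ?thesis by (simp add: mult_ac)
  qed
  note window = window_density[OF \<delta> pu_le L_lim, unfolded card_window]

  have "\<delta> = 1"
  proof -
    obtain p q where cut: "is_cut w u v p q" "u p = 0" "v q = 0" "int p - int q = 0"
      using decomposition_blocks_cut assms(10) unfolding zero_hat_def by blast
    have "pu p k = pv q k" for k using cut_slope[OF cut(1), of k] cut(4) by simp
    then have "{j. j < L k \<and> u (pu p k + j) = v (pu p k + j)} = {..<L k}" for k
      using u_window[OF cut(2)] v_window[OF cut(3)] by auto
    then have "(\<lambda>k. real (L k) / real (L k)) \<longlonglongrightarrow> \<delta>" using window[of p] by simp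
    moreover
    \<comment> \<open>The quotient is 1 only for \<open>L k > 0\<close>, as division by zero gives
      0; growth of \<open>L\<close> excludes that case eventually.\<close>
    have "\<forall>\<^sub>F k in sequentially. real (L k) / real (L k) = 1"
      using L_lim eventually_gt_at_top[of 0] by (auto simp: filterlim_iff elim: eventually_mono)
    then have "(\<lambda>k. real (L k) / real (L k)) \<longlonglongrightarrow> 1" by (rule tendsto_eventually)
    ultimately show ?thesis by (rule LIMSEQ_unique)
  qed
  moreover have "\<delta> \<le> 1 - 1 / real B"
  proof -
    obtain p q where cut: "is_cut w u v p q" "u p = 0" "v q = 0" "int p - int q = 1"
      using decomposition_blocks_cut assms(11) unfolding zero_hat_skewed_def by blast
    have pq: "pu p k = Suc (pv q k)" for k using cut_slope[OF cut(1), of k] cut(4) by simp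
    have "real (card {j. j < L k \<and> u (pu p k + j) = v (pu p k + j)}) / real (L k) \<le> 1 - 1 / real B"
      if k: "m \<le> 2 * k" for k
    proof -
      let ?S = "{j. j < L k \<and> u (pu p k + j) = v (pu p k + j)}"
      let ?T = "{j. Suc j < length (x k) \<and> x k ! j \<noteq> x k ! Suc j}"
      \<comment> \<open>The lower copy of \<open>x k\<close> starts one column earlier, so at offset
        \<open>j\<close> the letter \<open>x k ! j\<close> lies above \<open>x k ! Suc j\<close>.
        The last column, where the lower copy has already ended, is left out of
        \<open>?T\<close>.\<close>
      have "?S \<inter> ?T = {}"
      proof -
        have "v (pu p k + j) = x k ! Suc j" if "Suc j < L k" for j
          using v_window[OF cut(3) that] pq by simp
        then show ?thesis using u_window[OF cut(2)] by (auto simp: L_def)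
      qed
      then have "card ?S + card ?T = card (?S \<union> ?T)"
        by (intro card_Un_disjoint[symmetric]) (auto simp: finite_changes)
      also have "\<dots> \<le> card {..<L k}" by (intro card_mono) (auto simp: L_def)
      finally have ST: "card ?S + changes (x k) \<le> L k" unfolding changes_def by simp
      \<comment> \<open>Reserving the last \<open>m\<close> applications makes each letter of the
        \<open>n\<close>-th iterate contribute a change, while \<open>L k\<close> is at most
        \<open>B\<close> times the number of those letters.\<close>
      obtain n where n: "2 * k = m + n" using k le_Suc_ex by blast
      have "length (iter_subst \<theta> n [0]) \<le> changes (x k)"
        unfolding x_def n iter_subst_add
        by (rule changes_iter_subst[OF sub m set_iter_subst[OF sub]]) auto
      then have LB: "L k \<le> changes (x k) * B"
        using B_image[of n] unfolding L_def x_def n by (meson mult_le_mono1 order_trans)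
      have "Suc 0 \<le> L k"
        using length_iter_subst_mono[OF sub, of "[0]" 0 "2 * k"] unfolding L_def x_def by simp
      then have L0: "0 < real (L k)" by linarith
      have "real (L k) \<le> real (changes (x k)) * real B"
        using LB by (metis of_nat_le_iff of_nat_mult)
      then have "real (L k) / real B \<le> real (changes (x k))"
        using B0 by (simp add: field_simps)
      then have "real (card ?S) \<le> (1 - 1 / real B) * real (L k)"
        using ST by (simp add: algebra_simps)
      then show ?thesis using L0 by (simp add: pos_divide_le_eq)
    qed
    then show ?thesis
      by (intro LIMSEQ_le_const2[OF window[of p]] exI[of _ m]) simp
  qed
  ultimately show False using B0 by simp
qed

end
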